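(* Let $x_s\in\mathbb{R}$, let $n\ge 1$, and let $f$ be a real-valued function that is continuous on a neighborhood $U$ of $x_s$ and $n$-times differentiable with continuous first derivative $f'$ on $U\setminus\{x_s\}$, and suppose that $f'$ has a singularity at $x_s$ with left critical exponent $\mathcal{P}_{+}[f'](x_s)=\alpha$. Let $\beta\in[0,1)$. Then, as $\epsilon\to 0^+$: (i) if $\beta<|1-\alpha|$, then $\lim_{\epsilon\to 0}\upsilon_{\beta}^{\epsilon+}[f](x_s-\epsilon)=0$; (ii) if $\beta=|1-\alpha|$, then $\lim_{\epsilon\to 0}\upsilon_{\beta}^{\epsilon+}[f](x_s-\epsilon)$ is finite; (iii) if $\beta>|1-\alpha|$, then $\upsilon_{\beta}^{\epsilon+}[f](x_s-\epsilon)$ is unbounded as $\epsilon\to 0$. Moreover, for every $x\in U$ with $x\neq x_s$, $\lim_{\epsilon\to 0}\upsilon_{\beta}^{\epsilon+}[f](x)=0$.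
   Context: For $\epsilon>0$ and a real exponent $\beta$, the forward fractal variation of $f$ at $x$ is $\upsilon_{\beta}^{\epsilon+}[f](x):=\dfrac{f(x+\epsilon)-f(x)}{\epsilon^{\beta}}$. Thus $\upsilon_{\beta}^{\epsilon+}[f](x_s-\epsilon)=\dfrac{f(x_s)-f(x_s-\epsilon)}{\epsilon^\beta}$. For a function $g$ that is continuous away from a singularity at $x_s$, the left critical exponent $\mathcal{P}_{+}[g](x_s)$ is the minimal exponent $\alpha$ such that $\lim_{h\to 0^+}h^{\alpha}g(x_s-h)$ exists and satisfies $0<\left|\lim_{h\to 0^+}h^{\alpha}g(x_s-h)\right|<\infty$; if $g$ is bounded (near $x_s$), then $\mathcal{P}_{+}[g](x_s):=0$. *)

theory Defs
  imports "HOL-Analysis.Analysis"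
begin

definition forward_variation :: "real \<Rightarrow> real \<Rightarrow> (real \<Rightarrow> real) \<Rightarrow> real \<Rightarrow> real" where
  "forward_variation \<beta> \<epsilon> f x = (f (x + \<epsilon>) - f x) / \<epsilon> powr \<beta>"

text \<open>A singularity is a point to which the function does not extend continuously. The value
  of the function at the point itself, which for a derivative may be a meaningless default,
  plays no role. Jumps and bounded oscillation count as singularities.\<close>

definition has_singularity :: "(real \<Rightarrow> real) \<Rightarrow> real \<Rightarrow> bool" where
  "has_singularity g x \<longleftrightarrow> \<not> (\<exists>l. (g \<longlongrightarrow> l) (at x))"

definition left_exponents :: "(real \<Rightarrow> real) \<Rightarrow> real \<Rightarrow> real set" where
  "left_exponents g x =
     {a. \<exists>l. l \<noteq> 0 \<and> ((\<lambda>h. h powr a * g (x - h)) \<longlongrightarrow> l) (at_right 0)}"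

text \<open>The critical exponent is a relation rather than a function because it need not exist.
  Only the behaviour to the left of the point matters, so boundedness is also required only
  there. The bounded case takes precedence: a function vanishing like a positive power of the
  distance has exponent 0, not a negative one.\<close>

definition has_left_critical_exponent :: "(real \<Rightarrow> real) \<Rightarrow> real \<Rightarrow> real \<Rightarrow> bool" where
  "has_left_critical_exponent g x \<alpha> \<longleftrightarrow>
     (if Bfun g (at_left x) then \<alpha> = 0
      else \<alpha> \<in> left_exponents g x \<and> (\<forall>a\<in>left_exponents g x. \<alpha> \<le> a))"

end

theory Submission
  imports Defs "HOL-Real_Asymp.Real_Asymp"
begin

text \<open>Put \<open>D h = f x\<^sub>s - f (x\<^sub>s - h)\<close>, so that \<open>D' h = f' (x\<^sub>s - h)\<close> and \<open>D h \<longrightarrow> 0\<close> by continuity.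
  If \<open>f'\<close> is bounded to the left of \<open>x\<^sub>s\<close>, then \<open>D h = O(h)\<close>. Otherwise \<open>h powr \<alpha> * D' h\<close> tends to
  some \<open>l \<noteq> 0\<close>. Unboundedness forces \<open>\<alpha> > 0\<close>; \<open>\<alpha> \<ge> 1\<close> would make \<open>D\<close> diverge, so
  \<open>0 < \<alpha> < 1\<close> and L'Hopital's rule gives \<open>D h / h powr (1 - \<alpha>) \<longrightarrow> l / (1 - \<alpha>) \<noteq> 0\<close>.\<close>

text \<open>The reflection \<open>h = x - y\<close> moves everything to the right of 0. Critical
  exponents are limits in \<open>h\<close>, whereas boundedness in their definition is stated at the
  left of the singular point.\<close>

lemma eventually_at_left_iff_at_right_0:
  fixes x :: real
  shows "eventually P (at_left x) \<longleftrightarrow> eventually (\<lambda>h. P (x - h)) (at_right 0)"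
  unfolding eventually_at_left_to_right eventually_at_right_to_0[of _ "- x"] by simp

lemma Bfun_at_left_iff_at_right_0:
  fixes x :: real
  shows "Bfun g (at_left x) \<longleftrightarrow> Bfun (\<lambda>h. g (x - h)) (at_right 0)"
  by (simp add: Bfun_metric_def eventually_at_left_iff_at_right_0)

lemma powr_tendsto_0_at_right:
  fixes c :: real
  assumes "c > 0"
  shows "((\<lambda>h. h powr c) \<longlongrightarrow> 0) (at_right 0)"
  using assms by real_asymp

lemma powr_at_top_at_right:
  fixes c :: real
  assumes "c < 0"
  shows "filterlim (\<lambda>h. h powr c) at_top (at_right 0)"
  using assms by real_asymp

lemma Bfun_mult_tendsto_0:
  fixes f g :: "'a \<Rightarrow> real"
  assumes "Bfun f F" "(g \<longlongrightarrow> 0) F"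
  shows "((\<lambda>x. f x * g x) \<longlongrightarrow> 0) F"
  using bounded_bilinear.Bfun_prod_Zfun[OF bounded_bilinear_mult assms(1)] assms(2)
  by (simp add: tendsto_Zfun_iff)

lemma tendsto_imp_Bfun:
  fixes f :: "'a \<Rightarrow> real"
  assumes "(f \<longlongrightarrow> l) F"
  shows "Bfun f F"
proof -
  have "eventually (\<lambda>x. dist (f x) l < 1) F"
    using assms by (rule tendstoD) simp
  then have "eventually (\<lambda>x. dist (f x) l \<le> 1) F"
    by eventually_elim simp
  then show ?thesis
    unfolding Bfun_metric_def by (meson zero_less_one)
qed

lemma DERIV_powr_at_right:
  fixes c :: real
  shows "eventually (\<lambda>h. DERIV (\<lambda>h. h powr c) h :> c * h powr (c - 1)) (at_right 0)"
  using eventually_at_right_less[of 0]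
  by eventually_elim (auto intro: has_real_derivative_powr)

lemma powr_neq_0_at_right:
  fixes c d :: real
  assumes "c \<noteq> 0"
  shows "eventually (\<lambda>h. c * h powr d \<noteq> 0) (at_right 0)"
  using eventually_at_right_less[of 0] by eventually_elim (use assms in auto)

text \<open>For \<alpha> \<ge> 1 the function \<open>g\<close> behaves like a nonzero multiple of
  \<open>h powr (- \<alpha>)\<close>, which is not integrable at 0. L'Hopital's rule then makes
  \<open>D\<close> comparable to the primitive \<open>- ln h\<close> or
  \<open>h powr (1 - \<alpha>)\<close>, up to a nonzero factor. Both blow up, so \<open>D\<close>
  cannot tend to 0.\<close>

lemma exponent_less_1_of_primitive_tendsto_0:
  fixes D g :: "real \<Rightarrow> real"
  assumes D0: "(D \<longlongrightarrow> 0) (at_right 0)"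
    and D': "eventually (\<lambda>h. DERIV D h :> g h) (at_right 0)"
    and lim: "((\<lambda>h. h powr \<alpha> * g h) \<longlongrightarrow> l) (at_right 0)" and "l \<noteq> 0"
  shows "\<alpha> < 1"
proof (rule ccontr)
  assume "\<not> \<alpha> < 1"
  then consider "\<alpha> = 1" | "\<alpha> > 1" by linarith
  then show False
  proof cases
    case 1
    let ?G = "\<lambda>h::real. - ln h"
    have top: "filterlim ?G at_top (at_right 0)" by real_asymp
    \<comment> \<open>This form of L'Hopital's rule asks only the denominator to diverge, so it
      applies although \<open>D\<close> tends to 0. That same fact makes the quotient tend to 0,
      against the nonzero limit found here.\<close>
    have "((\<lambda>h. D h / ?G h) \<longlongrightarrow> - l) (at_right 0)"
    proof (rule lhopital_right_0_at_top[OF top _ D'])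
      show "eventually (\<lambda>h::real. - (1 / h) \<noteq> 0) (at_right 0)"
        using eventually_at_right_less[of 0] by eventually_elim auto
      show "eventually (\<lambda>h. DERIV ?G h :> - (1 / h)) (at_right 0)"
        using eventually_at_right_less[of 0]
        by eventually_elim (auto intro!: derivative_eq_intros)
      have "((\<lambda>h. - (h powr \<alpha> * g h)) \<longlongrightarrow> - l) (at_right 0)"
        using lim by (rule tendsto_minus)
      moreover have "eventually (\<lambda>h. - (h powr \<alpha> * g h) = g h / - (1 / h)) (at_right 0)"
        using eventually_at_right_less[of 0] by eventually_elim (use 1 in auto)
      ultimately show "((\<lambda>h. g h / - (1 / h)) \<longlongrightarrow> - l) (at_right 0)"
        by (rule Lim_transform_eventually)
    qed
    moreover have "((\<lambda>h. D h / ?G h) \<longlongrightarrow> 0) (at_right 0)"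
      using D0 filterlim_at_top_imp_at_infinity[OF top] by (rule tendsto_divide_0)
    ultimately show False
      using \<open>l \<noteq> 0\<close> tendsto_unique[OF trivial_limit_at_right_real] by fastforce
  next
    case 2
    let ?G = "\<lambda>h::real. h powr (1 - \<alpha>)"
    have top: "filterlim ?G at_top (at_right 0)"
      by (rule powr_at_top_at_right) (use 2 in simp)
    have "((\<lambda>h. D h / ?G h) \<longlongrightarrow> l / (1 - \<alpha>)) (at_right 0)"
    proof (rule lhopital_right_0_at_top[OF top powr_neq_0_at_right D' DERIV_powr_at_right])
      show "1 - \<alpha> \<noteq> 0" using 2 by simp
      \<comment> \<open>The exponent \<open>1 - \<alpha> - 1\<close> is - \<alpha>, so dividing by
        that power multiplies \<open>g h\<close> by \<open>h powr \<alpha>\<close>.\<close>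
      have "((\<lambda>h. h powr \<alpha> * g h / (1 - \<alpha>)) \<longlongrightarrow> l / (1 - \<alpha>)) (at_right 0)"
        using lim 2 by (intro tendsto_intros) auto
      then show "((\<lambda>h. g h / ((1 - \<alpha>) * h powr (1 - \<alpha> - 1))) \<longlongrightarrow> l / (1 - \<alpha>)) (at_right 0)"
        by (simp add: powr_minus field_simps)
    qed
    moreover have "((\<lambda>h. D h / ?G h) \<longlongrightarrow> 0) (at_right 0)"
      using D0 filterlim_at_top_imp_at_infinity[OF top] by (rule tendsto_divide_0)
    ultimately have "l / (1 - \<alpha>) = 0"
      using tendsto_unique[OF trivial_limit_at_right_real] by blast
    then show False using \<open>l \<noteq> 0\<close> 2 by simp
  qed
qed

lemma primitive_asymptotics_at_right_0:
  fixes D g :: "real \<Rightarrow> real"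
  assumes D0: "(D \<longlongrightarrow> 0) (at_right 0)"
    and D': "eventually (\<lambda>h. DERIV D h :> g h) (at_right 0)"
    and lim: "((\<lambda>h. h powr \<alpha> * g h) \<longlongrightarrow> l) (at_right 0)" and "\<alpha> < 1"
  shows "((\<lambda>h. D h / h powr (1 - \<alpha>)) \<longlongrightarrow> l / (1 - \<alpha>)) (at_right 0)"
proof (rule lhopital_right_0[OF D0 _ _ powr_neq_0_at_right D' DERIV_powr_at_right])
  show "((\<lambda>h. h powr (1 - \<alpha>)) \<longlongrightarrow> 0) (at_right 0)"
    by (rule powr_tendsto_0_at_right) (use \<open>\<alpha> < 1\<close> in simp)
  show "eventually (\<lambda>h. h powr (1 - \<alpha>) \<noteq> 0) (at_right 0)"
    using powr_neq_0_at_right[of 1] by simp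
  show "1 - \<alpha> \<noteq> 0" using \<open>\<alpha> < 1\<close> by simp
  have "((\<lambda>h. h powr \<alpha> * g h / (1 - \<alpha>)) \<longlongrightarrow> l / (1 - \<alpha>)) (at_right 0)"
    using lim \<open>\<alpha> < 1\<close> by (intro tendsto_intros) auto
  then show "((\<lambda>h. g h / ((1 - \<alpha>) * h powr (1 - \<alpha> - 1))) \<longlongrightarrow> l / (1 - \<alpha>)) (at_right 0)"
    by (simp add: powr_minus field_simps)
qed

text \<open>Instead of an estimate by the mean value theorem, the preceding lemma is applied with
  exponent \<open>1 - c\<close> for some \<open>c\<close> between \<beta> and 1. A bounded
  \<open>g\<close> times \<open>h powr (1 - c)\<close> tends to 0, hence so does
  \<open>D h / h powr c\<close>, and the remaining factor \<open>h powr (c - \<beta>)\<close>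
  vanishes too.\<close>

lemma primitive_of_bounded_at_right_0:
  fixes D g :: "real \<Rightarrow> real"
  assumes D0: "(D \<longlongrightarrow> 0) (at_right 0)"
    and D': "eventually (\<lambda>h. DERIV D h :> g h) (at_right 0)"
    and bdd: "Bfun g (at_right 0)" and "\<beta> < 1"
  shows "((\<lambda>h. D h / h powr \<beta>) \<longlongrightarrow> 0) (at_right 0)"
proof -
  \<comment> \<open>The midpoint of \<open>max \<beta> 0\<close> and 1. The maximum guarantees
    \<open>c > 0\<close> for negative \<beta> as well, so that the exponent \<open>1 - c\<close> is
    below 1.\<close>
  define c where "c = (max \<beta> 0 + 1) / 2"
  have c: "0 < c" "\<beta> < c" "c < 1" using \<open>\<beta> < 1\<close> by (auto simp: c_def)
  have "((\<lambda>h. g h * h powr (1 - c)) \<longlongrightarrow> 0) (at_right 0)"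
    by (rule Bfun_mult_tendsto_0[OF bdd powr_tendsto_0_at_right]) (use c in simp)
  then have "((\<lambda>h. h powr (1 - c) * g h) \<longlongrightarrow> 0) (at_right 0)"
    by (simp add: mult.commute)
  from primitive_asymptotics_at_right_0[OF D0 D' this]
  have "((\<lambda>h. D h / h powr c) \<longlongrightarrow> 0) (at_right 0)" using c by simp
  moreover have "((\<lambda>h. h powr (c - \<beta>)) \<longlongrightarrow> 0) (at_right 0)"
    by (rule powr_tendsto_0_at_right) (use c in simp)
  ultimately have "((\<lambda>h. D h / h powr c * h powr (c - \<beta>)) \<longlongrightarrow> 0) (at_right 0)"
    by (rule tendsto_mult_zero)
  moreover have "eventually (\<lambda>h. D h / h powr c * h powr (c - \<beta>) = D h / h powr \<beta>) (at_right 0)"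
    using eventually_at_right_less[of 0] by eventually_elim (simp add: powr_diff)
  ultimately show ?thesis by (rule Lim_transform_eventually)
qed

text \<open>The variation is the difference quotient, which converges, times
  \<open>h powr (1 - \<beta>)\<close>, which vanishes because \<beta> < 1.\<close>

lemma forward_variation_tendsto_0_of_DERIV:
  assumes "DERIV f x :> d" "\<beta> < 1"
  shows "((\<lambda>\<epsilon>. forward_variation \<beta> \<epsilon> f x) \<longlongrightarrow> 0) (at_right 0)"
proof -
  have "((\<lambda>h. (f (x + h) - f x) / h) \<longlongrightarrow> d) (at_right 0)"
    using assms(1) unfolding DERIV_def by (rule filterlim_mono) (simp_all add: at_within_le_at)
  then have "((\<lambda>h. (f (x + h) - f x) / h * h powr (1 - \<beta>)) \<longlongrightarrow> d * 0) (at_right 0)"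
    by (rule tendsto_mult[OF _ powr_tendsto_0_at_right]) (use assms in simp)
  moreover have "eventually (\<lambda>h. (f (x + h) - f x) / h * h powr (1 - \<beta>)
      = forward_variation \<beta> h f x) (at_right 0)"
    using eventually_at_right_less[of 0]
    by eventually_elim (simp add: powr_diff forward_variation_def)
  ultimately show ?thesis
    by (simp add: Lim_transform_eventually)
qed

text \<open>For \<alpha> \<le> 0 the factor \<open>h powr (- \<alpha>)\<close> has a finite limit.
  Multiplying by it recovers \<open>g\<close>, which would then converge and hence be
  bounded.\<close>

lemma unbounded_exponent_pos:
  fixes g :: "real \<Rightarrow> real"
  assumes lim: "((\<lambda>h. h powr \<alpha> * g h) \<longlongrightarrow> l) (at_right 0)" and unbdd: "\<not> Bfun g (at_right 0)"
  shows "\<alpha> > 0"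
proof (rule ccontr)
  assume "\<not> \<alpha> > 0"
  \<comment> \<open>At \<alpha> = 0 the power is constantly 1 for \<open>h > 0\<close>; for \<alpha>
    < 0 the exponent is positive and the power vanishes.\<close>
  then have "((\<lambda>h. h powr (- \<alpha>)) \<longlongrightarrow> (if \<alpha> = 0 then 1 else 0)) (at_right 0)"
    using powr_tendsto_0_at_right[of "- \<alpha>"] by (auto intro!: tendsto_eventually
      eventually_mono[OF eventually_at_right_less[of 0]])
  from tendsto_mult[OF lim this] obtain m
    where "((\<lambda>h. h powr \<alpha> * g h * h powr (- \<alpha>)) \<longlongrightarrow> m) (at_right 0)" by blast
  moreover have "eventually (\<lambda>h. h powr \<alpha> * g h * h powr (- \<alpha>) = g h) (at_right 0)"
    using eventually_at_right_less[of 0] by eventually_elim (simp add: powr_minus)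
  ultimately have "(g \<longlongrightarrow> m) (at_right 0)" by (rule Lim_transform_eventually)
  then show False using unbdd tendsto_imp_Bfun by blast
qed

theorem theorem6:
  fixes f :: "real \<Rightarrow> real" and U :: "real set" and x\<^sub>s \<alpha> \<beta> :: real and n :: nat
  assumes "open U" and "x\<^sub>s \<in> U"
    and "n \<ge> 1"
    and "continuous_on U f"
    and "\<forall>k<n. (deriv ^^ k) f differentiable_on (U - {x\<^sub>s})"
    and "continuous_on (U - {x\<^sub>s}) (deriv f)"
    and "has_singularity (deriv f) x\<^sub>s"
    and "has_left_critical_exponent (deriv f) x\<^sub>s \<alpha>"
    and "0 \<le> \<beta>" and "\<beta> < 1"
  shows "(\<beta> < \<bar>1 - \<alpha>\<bar> \<longrightarrow>
            ((\<lambda>\<epsilon>. forward_variation \<beta> \<epsilon> f (x\<^sub>s - \<epsilon>)) \<longlongrightarrow> 0) (at_right 0))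
       \<and> (\<beta> = \<bar>1 - \<alpha>\<bar> \<longrightarrow>
            (\<exists>l. ((\<lambda>\<epsilon>. forward_variation \<beta> \<epsilon> f (x\<^sub>s - \<epsilon>)) \<longlongrightarrow> l) (at_right 0)))
       \<and> (\<beta> > \<bar>1 - \<alpha>\<bar> \<longrightarrow>
            \<not> Bfun (\<lambda>\<epsilon>. forward_variation \<beta> \<epsilon> f (x\<^sub>s - \<epsilon>)) (at_right 0))
       \<and> (\<forall>x\<in>U. x \<noteq> x\<^sub>s \<longrightarrow>
            ((\<lambda>\<epsilon>. forward_variation \<beta> \<epsilon> f x) \<longlongrightarrow> 0) (at_right 0))"
proof -
  have der: "DERIV f x :> deriv f x" if "x \<in> U" "x \<noteq> x\<^sub>s" for x
  proof -
    \<comment> \<open>This is the instance \<open>k = 0\<close>, available since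
      \<open>n \<ge> 1\<close>: the zeroth iterate of \<open>deriv\<close> at \<open>f\<close> is
      \<open>f\<close> itself.\<close>
    have "f differentiable_on (U - {x\<^sub>s})" using assms(3,5) by (force dest: spec[of _ 0])
    then have "f differentiable at x"
      using that \<open>open U\<close> by (simp add: differentiable_on_eq_differentiable_at open_delete)
    then show ?thesis by (simp add: DERIV_deriv_iff_real_differentiable)
  qed
  define D where "D h = f x\<^sub>s - f (x\<^sub>s - h)" for h
  define g where "g h = deriv f (x\<^sub>s - h)" for h
  have cont: "isCont f x\<^sub>s"
    using assms(1,2,4) by (simp add: continuous_on_eq_continuous_at)
  have arg: "((\<lambda>h. x\<^sub>s - h) \<longlongrightarrow> x\<^sub>s) (at_right 0)"
    by (auto intro!: tendsto_eq_intros)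
  have D0: "(D \<longlongrightarrow> 0) (at_right 0)"
    using tendsto_diff[OF tendsto_const[of "f x\<^sub>s"] isCont_tendsto_compose[OF cont arg]]
    by (simp add: D_def[abs_def])
  \<comment> \<open>For small \<open>h > 0\<close> the point \<open>x\<^sub>s - h\<close> lies in
    \<open>U\<close> and differs from \<open>x\<^sub>s\<close>. The minus sign in \<open>D\<close>
    cancels the one from the inner function.\<close>
  have D': "eventually (\<lambda>h. DERIV D h :> g h) (at_right 0)"
    using topological_tendstoD[OF arg assms(1,2)] eventually_at_right_less[of 0]
  proof eventually_elim
    case (elim h)
    show ?case
      unfolding D_def[abs_def] g_def
      by (rule derivative_eq_intros DERIV_chain2[OF der] refl | use elim in simp)+
  qed
  have fv: "forward_variation \<beta> h f (x\<^sub>s - h) = D h / h powr \<beta>" for h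
    by (simp add: forward_variation_def D_def)
  have bdd_iff: "Bfun (deriv f) (at_left x\<^sub>s) \<longleftrightarrow> Bfun g (at_right 0)"
    by (simp add: Bfun_at_left_iff_at_right_0 g_def[abs_def])
  have "(\<beta> < \<bar>1 - \<alpha>\<bar> \<longrightarrow> ((\<lambda>h. D h / h powr \<beta>) \<longlongrightarrow> 0) (at_right 0))
      \<and> (\<beta> = \<bar>1 - \<alpha>\<bar> \<longrightarrow> (\<exists>l. ((\<lambda>h. D h / h powr \<beta>) \<longlongrightarrow> l) (at_right 0)))
      \<and> (\<beta> > \<bar>1 - \<alpha>\<bar> \<longrightarrow> \<not> Bfun (\<lambda>h. D h / h powr \<beta>) (at_right 0))"
  proof (cases "Bfun g (at_right 0)")
    case True
    then have "\<alpha> = 0" using assms(8) by (simp add: has_left_critical_exponent_def bdd_iff)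
    \<comment> \<open>With \<alpha> = 0 the threshold is 1 and \<beta> lies below it, so only the
      first of the three cases can occur.\<close>
    then show ?thesis
      using primitive_of_bounded_at_right_0[OF D0 D' True \<open>\<beta> < 1\<close>] \<open>\<beta> < 1\<close> by simp
  next
    case False
    then obtain l where l: "l \<noteq> 0" "((\<lambda>h. h powr \<alpha> * g h) \<longlongrightarrow> l) (at_right 0)"
      using assms(8) by (auto simp: has_left_critical_exponent_def bdd_iff left_exponents_def g_def)
    have "\<alpha> > 0" using l(2) False by (rule unbounded_exponent_pos)
    have "\<alpha> < 1" using D0 D' l(2,1) by (rule exponent_less_1_of_primitive_tendsto_0)
    define m where "m = l / (1 - \<alpha>)"
    have "m \<noteq> 0" using l(1) \<open>\<alpha> < 1\<close> by (simp add: m_def)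
    have lim: "((\<lambda>h. D h / h powr (1 - \<alpha>)) \<longlongrightarrow> m) (at_right 0)"
      unfolding m_def using D0 D' l(2) \<open>\<alpha> < 1\<close> by (rule primitive_asymptotics_at_right_0)
    \<comment> \<open>Below the threshold the quotient is the convergent
      \<open>D h / h powr (1 - \<alpha>)\<close> times a positive power of \<open>h\<close>.\<close>
    have "((\<lambda>h. D h / h powr \<beta>) \<longlongrightarrow> 0) (at_right 0)" if "\<beta> < 1 - \<alpha>"
    proof -
      have "((\<lambda>h. h powr (1 - \<alpha> - \<beta>)) \<longlongrightarrow> 0) (at_right 0)"
        by (rule powr_tendsto_0_at_right) (use that in simp)
      from tendsto_mult[OF lim this]
      have "((\<lambda>h. D h / h powr (1 - \<alpha>) * h powr (1 - \<alpha> - \<beta>)) \<longlongrightarrow> 0) (at_right 0)" by simp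
      moreover have "eventually (\<lambda>h. D h / h powr (1 - \<alpha>) * h powr (1 - \<alpha> - \<beta>)
          = D h / h powr \<beta>) (at_right 0)"
        using eventually_at_right_less[of 0]
        by eventually_elim (simp add: powr_diff[of _ "1 - \<alpha>" \<beta>])
      ultimately show ?thesis by (rule Lim_transform_eventually)
    qed
    \<comment> \<open>Above the threshold the factorisation is reversed: if
      \<open>D h / h powr \<beta>\<close> were bounded, a positive power of \<open>h\<close> times
      it would vanish. But that product is \<open>D h / h powr (1 - \<alpha>)\<close>, whose limit
      \<open>m\<close> is nonzero.\<close>
    moreover have False
      if "\<beta> > 1 - \<alpha>" and bdd: "Bfun (\<lambda>h. D h / h powr \<beta>) (at_right 0)"
    proof -
      have "((\<lambda>h. D h / h powr \<beta> * h powr (\<beta> - (1 - \<alpha>))) \<longlongrightarrow> 0) (at_right 0)"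
        by (rule Bfun_mult_tendsto_0[OF bdd powr_tendsto_0_at_right]) (use that in simp)
      moreover have "eventually (\<lambda>h. D h / h powr \<beta> * h powr (\<beta> - (1 - \<alpha>))
          = D h / h powr (1 - \<alpha>)) (at_right 0)"
        using eventually_at_right_less[of 0]
        by eventually_elim (simp add: powr_diff[of _ \<beta> "1 - \<alpha>"])
      ultimately have "((\<lambda>h. D h / h powr (1 - \<alpha>)) \<longlongrightarrow> 0) (at_right 0)"
        by (rule Lim_transform_eventually)
      then show False
        using lim \<open>m \<noteq> 0\<close> tendsto_unique[OF trivial_limit_at_right_real] by blast
    qed
    \<comment> \<open>Since \<alpha> < 1, the absolute value is \<open>1 - \<alpha>\<close>, and at
      equality the required limit is \<open>m\<close> itself.\<close>
    ultimately show ?thesis using lim \<open>\<alpha> < 1\<close> by auto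
  qed
  then show ?thesis
    unfolding fv using forward_variation_tendsto_0_of_DERIV[OF der \<open>\<beta> < 1\<close>] by blast
qed

end
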